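(* Let $\mu>0$, $s>0$, and let $\varphi:\mathbb{R}\to\mathbb{R}$ be strictly convex on $\mathbb{R}$, differentiable on $\mathbb{R}\setminus\{\mu\}$, with $\lim_{|x|\to\infty}|\varphi(x)/x|=\infty$, $\varphi(\mu)=0$, and global minimum attained at $\mu$. Let $t\in\mathbb{R}$. Then the solution to $$\max_{\mathbb{P}\in\mathcal{P}(\mu,s,\varphi)}\mathbb{E}(\max\{X-t,0\})$$ is the unique two-point distribution with mean $\mu$ whose support points $v_1<\mu<v_2$ solve the system $$(v_1-t)\varphi'(v_1)-\varphi(v_1)=(v_2-t)\varphi'(v_2)-\varphi(v_2),$$ $$\frac{v_2-\mu}{v_2-v_1}\varphi(v_1)+\frac{\mu-v_1}{v_2-v_1}\varphi(v_2)=s.$$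
   Context: $\mathcal{P}(\mu,s,\varphi)$ is the set of all probability distributions $\mathbb{P}$ on $\mathbb{R}$ such that, for $X\sim\mathbb{P}$, $\mathbb{E}_{\mathbb{P}}(X)=\mu$ and $\mathbb{E}_{\mathbb{P}}(\varphi(X))=s$. A two-point distribution is a distribution supported on two points $v_1<\mu<v_2$ with probability masses $w_1,w_2$; with mean $\mu$ these masses are $w_1=(v_2-\mu)/(v_2-v_1)$ and $w_2=(\mu-v_1)/(v_2-v_1)$. *)

theory Defs
  imports "HOL-Probability.Probability"
begin

definition strictly_convex_on :: "real set \<Rightarrow> (real \<Rightarrow> real) \<Rightarrow> bool" where
  "strictly_convex_on S f \<longleftrightarrow>
     convex S \<and>
     (\<forall>x\<in>S. \<forall>y\<in>S. \<forall>u. x \<noteq> y \<and> 0 < u \<and> u < 1 \<longrightarrow>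
        f ((1 - u) * x + u * y) < (1 - u) * f x + u * f y)"

text \<open>The Bochner integral of a non-integrable function is \<open>0\<close>, so a prescribed expectation has
  to include integrability.\<close>

definition has_expectation :: "real measure \<Rightarrow> (real \<Rightarrow> real) \<Rightarrow> real \<Rightarrow> bool" where
  "has_expectation P f c \<longleftrightarrow> integrable P f \<and> (\<integral>x. f x \<partial>P) = c"

definition ambiguity_set :: "real \<Rightarrow> real \<Rightarrow> (real \<Rightarrow> real) \<Rightarrow> real measure set" where
  "ambiguity_set \<mu> s \<phi> =
     {P. real_distribution P \<and> has_expectation P (\<lambda>x. x) \<mu> \<and> has_expectation P \<phi> s}"

definition two_point_distribution ::
    "real measure \<Rightarrow> real \<Rightarrow> real \<Rightarrow> real \<Rightarrow> real \<Rightarrow> bool" where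
  "two_point_distribution P v1 v2 w1 w2 \<longleftrightarrow>
     real_distribution P \<and> v1 < v2 \<and> 0 < w1 \<and> 0 < w2 \<and> w1 + w2 = 1 \<and>
     measure P {v1} = w1 \<and> measure P {v2} = w2"

lemma two_point_distribution_integral:
  fixes f :: "real \<Rightarrow> real"
  assumes "two_point_distribution P v1 v2 w1 w2" and f: "f \<in> borel_measurable borel"
  shows "has_expectation P f (w1 * f v1 + w2 * f v2)"
proof -
  interpret real_distribution P
    using assms(1) by (simp add: two_point_distribution_def)
  have v: "v1 < v2" and w: "w1 + w2 = 1" "measure P {v1} = w1" "measure P {v2} = w2"
    using assms(1) by (auto simp: two_point_distribution_def)
  let ?g = "\<lambda>x. f v1 * indicator {v1} x + f v2 * indicator {v2} x :: real"
  have "prob ({v1} \<union> {v2}) = 1"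
    using v w by (subst finite_measure_Union) auto
  then have "AE x in P. x \<in> {v1} \<union> {v2}"
    by (subst (asm) prob_eq_1) auto
  then have ae: "AE x in P. f x = ?g x"
    by eventually_elim (use v in auto)
  have f': "f \<in> borel_measurable P"
    using f by simp
  have "has_bochner_integral P ?g (f v1 * measure P {v1} + f v2 * measure P {v2})"
    by (intro has_bochner_integral_add has_bochner_integral_mult_right
        has_bochner_integral_real_indicator) (auto simp: emeasure_eq_measure)
  then have "has_bochner_integral P f (w1 * f v1 + w2 * f v2)"
    using ae f' w
    by (subst has_bochner_integral_cong_AE[where g = ?g]) (auto simp: mult.commute)
  then show ?thesis
    by (simp add: has_expectation_def has_bochner_integral_iff)
qed

lemma two_point_distribution_masses:
  assumes "two_point_distribution P v1 v2 w1 w2" and "has_expectation P (\<lambda>x. x) \<mu>"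
  shows "w1 = (v2 - \<mu>) / (v2 - v1)" and "w2 = (\<mu> - v1) / (v2 - v1)"
proof -
  have m: "\<mu> = w1 * v1 + w2 * v2"
    using two_point_distribution_integral[OF assms(1), of "\<lambda>x. x"] assms(2)
    by (simp add: has_expectation_def)
  have v: "v1 < v2" and w: "w1 = 1 - w2"
    using assms(1) by (auto simp: two_point_distribution_def)
  have "v2 - \<mu> = w1 * (v2 - v1)" "\<mu> - v1 = w2 * (v2 - v1)"
    unfolding m w by (simp_all add: algebra_simps)
  then show "w1 = (v2 - \<mu>) / (v2 - v1)" "w2 = (\<mu> - v1) / (v2 - v1)"
    using v by simp_all
qed

end

theory Submission
  imports Defs
begin

text \<open>
  The first equation of the system says that the tangents of \<open>\<phi>\<close> at \<open>v1\<close> and at \<open>v2\<close> take the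
  same value at \<open>t\<close>. The second one says that the chord of \<open>\<phi>\<close> from \<open>v1\<close> to \<open>v2\<close> passes through
  the point \<open>(\<mu>, s)\<close>.

  Optimality is linear programming duality. If the two tangents meet above \<open>t\<close>, their difference
  is a multiple of \<open>x - t\<close>, namely by \<open>d = \<phi>' v2 - \<phi>' v1 > 0\<close>. So the function \<open>F\<close> obtained
  by subtracting from \<open>\<phi>\<close> its tangent at \<open>v1\<close> and dividing by \<open>d\<close> equals \<open>x - t\<close> plus the
  gap between \<open>\<phi>\<close> and its tangent at \<open>v2\<close>, divided by \<open>d\<close>. By strict convexity \<open>F\<close> majorizes
  \<open>max (x - t) 0\<close> and touches it exactly at \<open>v1\<close> and \<open>v2\<close> (\<open>tangents_meet_majorant\<close>).
  As \<open>F\<close> is an affine function plus a multiple of \<open>\<phi>\<close>, its expectation is the same under every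
  distribution of the ambiguity set; it bounds the expected excess over \<open>t\<close>, and the bound is
  attained only by distributions concentrated on \<open>v1\<close> and \<open>v2\<close>, of which the mean leaves just one
  (\<open>is_arg_max_iff_two_point\<close>). Every solution of the system is therefore the unique
  maximizer, and in particular two solutions give the same distribution. It remains to
  find one solution.

  Existence is an intermediate value argument (\<open>common_tangent_supports_exist\<close>). The line of slope
  \<open>c\<close> through \<open>(\<mu>, s)\<close> cuts the graph of \<open>\<phi>\<close> once on each side of \<open>\<mu>\<close>, in points that depend
  continuously on \<open>c\<close>. As \<open>c\<close> tends to infinity, the right point escapes to infinity and its
  tangent at \<open>t\<close> falls below every bound, because \<open>\<phi>\<close> grows superlinearly; meanwhile the left point
  stays close to \<open>\<mu>\<close>, where the tangents at \<open>t\<close> are bounded below. For \<open>c\<close> tending to minus infinity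
  the sides change their roles, so for some \<open>c\<close> the two tangent values agree. The left side is
  obtained from the right side by reflection in \<open>\<mu>\<close>. The kink that \<open>\<phi>\<close> may have at \<open>\<mu>\<close> does no harm,
  as both points avoid \<open>\<mu>\<close> and the derivative is continuous elsewhere.
\<close>

section \<open>Tangents of a convex function with a kink at its minimum\<close>

definition tangent :: "(real \<Rightarrow> real) \<Rightarrow> real \<Rightarrow> real \<Rightarrow> real" where
  "tangent f v x = f v + deriv f v * (x - v)"

text \<open>The growth condition is stated in the distance from \<open>m\<close> rather than as a limit, which makes it
  visibly invariant under reflection in \<open>m\<close>.\<close>

locale convex_well =
  fixes f :: "real \<Rightarrow> real" and m :: real
  assumes strictly_convex: "strictly_convex_on UNIV f"
    and differentiable: "\<And>x. x \<noteq> m \<Longrightarrow> f differentiable (at x)"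
    and minimum: "f m = 0" "\<And>x. 0 \<le> f x"
    and superlinear: "\<And>K. \<exists>R. \<forall>x. R \<le> \<bar>x - m\<bar> \<longrightarrow> K * \<bar>x - m\<bar> \<le> f x"
begin

lemma strict_chord: "x \<noteq> y \<Longrightarrow> 0 < u \<Longrightarrow> u < 1 \<Longrightarrow> f ((1 - u) * x + u * y) < (1 - u) * f x + u * f y"
  using strictly_convex by (simp add: strictly_convex_on_def)

lemma convex: "convex_on UNIV f"
proof (rule convex_onI)
  fix u x y :: real
  assume "0 < u" "u < 1"
  then show "f ((1 - u) *\<^sub>R x + u *\<^sub>R y) \<le> (1 - u) * f x + u * f y"
    using strict_chord[of x y u] by (cases "x = y") (auto simp: algebra_simps)
qed simp

lemma continuous: "continuous_on A f"
  using convex_on_continuous[OF open_UNIV convex] by (rule continuous_on_subset) simp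

lemma borel_measurable: "f \<in> borel_measurable borel"
  by (rule borel_measurable_continuous_onI) (rule continuous)

lemma has_deriv: "x \<noteq> m \<Longrightarrow> (f has_real_derivative deriv f x) (at x)"
  using differentiable by (auto simp: DERIV_deriv_iff_real_differentiable)

lemma tangent_le: "v \<noteq> m \<Longrightarrow> tangent f v x \<le> f x"
  using convex_on_imp_above_tangent[OF convex, of v x "deriv f v"] has_deriv[of v]
  by (simp add: tangent_def)

text \<open>Touching the graph a second time is impossible: at the midpoint the graph would have to lie
  both above the tangent and strictly below the chord.\<close>

lemma tangent_less:
  assumes "v \<noteq> m" "x \<noteq> v"
  shows "tangent f v x < f x"
proof -
  have "tangent f v ((1 - 1/2) * v + 1/2 * x) < (1 - 1/2) * f v + 1/2 * f x"
    using tangent_le[OF assms(1)] strict_chord[of v x "1/2"] assms(2)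
    by (rule_tac le_less_trans) auto
  then show ?thesis
    by (simp add: tangent_def field_simps)
qed

lemma deriv_less:
  assumes "v < w" "v \<noteq> m" "w \<noteq> m"
  shows "deriv f v < deriv f w"
proof -
  have "0 < (deriv f w - deriv f v) * (w - v)"
    using tangent_less[of v w] tangent_less[of w v] assms
    by (simp add: tangent_def algebra_simps)
  then show ?thesis
    using assms(1) by (simp add: zero_less_mult_iff)
qed

text \<open>Secant slopes from a fixed second point \<open>y\<close> bound the derivative at \<open>z\<close> on one side and depend
  continuously on \<open>z\<close>. Choosing \<open>y\<close> so that the slope at \<open>x\<close> is close to \<open>deriv f x\<close> gives both
  halves of continuity.\<close>

lemma isCont_deriv:
  assumes "x \<noteq> m"
  shows "isCont (deriv f) x"
proof -
  have quot: "((\<lambda>y. (f y - f x) / (y - x)) \<longlongrightarrow> deriv f x) (at x)"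
    using has_deriv[OF assms] by (simp add: has_field_derivative_iff)
  have isCont: "isCont f z" for z
    using continuous[of UNIV] by (simp add: continuous_on_eq_continuous_at)
  have ne: "\<forall>\<^sub>F z in at x. z \<noteq> m"
    using assms by (intro t1_space_nhds eventually_at_topological[THEN iffD2] exI[of _ "-{m}"]) auto
  have near: "((\<lambda>z. (f y - f z) / (y - z)) \<longlongrightarrow> (f y - f x) / (y - x)) (at x)" if "y \<noteq> x" for y
    using isCont that by (intro tendsto_intros) (auto simp: isCont_def)
  show ?thesis
    unfolding isCont_def
  proof (rule order_tendstoI)
    fix a assume "a < deriv f x"
    with quot have "\<forall>\<^sub>F y in at_left x. a < (f y - f x) / (y - x)"
      using order_tendstoD(1) eventually_at_split by blast
    moreover have "\<forall>\<^sub>F y in at_left x. y < x"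
      by (simp add: eventually_at_filter)
    ultimately have "\<exists>y. a < (f y - f x) / (y - x) \<and> y < x"
      by (intro eventually_happens'[of "at_left x"] eventually_conj) auto
    then obtain y where y: "a < (f y - f x) / (y - x)" "y < x"
      by blast
    have "\<forall>\<^sub>F z in at x. a < (f y - f z) / (y - z)"
      using near y by (intro order_tendstoD(1)) auto
    moreover have "\<forall>\<^sub>F z in at x. y < z"
      using order_tendstoD(1)[OF tendsto_ident_at y(2)] .
    ultimately show "\<forall>\<^sub>F z in at x. a < deriv f z"
      using ne
    proof eventually_elim
      case (elim z)
      then have "(f y - f z) / (y - z) \<le> deriv f z"
        using tangent_le[of z y] by (simp add: tangent_def field_simps)
      with elim show ?case by simp
    qed
  next
    fix a assume "deriv f x < a"
    with quot have "\<forall>\<^sub>F y in at_right x. (f y - f x) / (y - x) < a"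
      using order_tendstoD(2) eventually_at_split by blast
    moreover have "\<forall>\<^sub>F y in at_right x. x < y"
      by (simp add: eventually_at_filter)
    ultimately have "\<exists>y. (f y - f x) / (y - x) < a \<and> x < y"
      by (intro eventually_happens'[of "at_right x"] eventually_conj) auto
    then obtain y where y: "(f y - f x) / (y - x) < a" "x < y"
      by blast
    have "\<forall>\<^sub>F z in at x. (f y - f z) / (y - z) < a"
      using near y by (intro order_tendstoD(2)) auto
    moreover have "\<forall>\<^sub>F z in at x. z < y"
      using order_tendstoD(2)[OF tendsto_ident_at y(2)] .
    ultimately show "\<forall>\<^sub>F z in at x. deriv f z < a"
      using ne
    proof eventually_elim
      case (elim z)
      then have "deriv f z \<le> (f y - f z) / (y - z)"
        using tangent_le[of z y] by (simp add: tangent_def field_simps)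
      with elim show ?case by simp
    qed
  qed
qed

lemma isCont_tangent: "v \<noteq> m \<Longrightarrow> isCont (\<lambda>v. tangent f v x) v"
  unfolding tangent_def
  using isCont_deriv continuous[of UNIV]
  by (intro continuous_intros) (auto simp: continuous_on_eq_continuous_at)

text \<open>The tangent at \<open>v\<close> lies below the graph at a point \<open>c\<close> to the right of \<open>t\<close>, and going back from
  \<open>c\<close> to \<open>t\<close> it drops by its slope times \<open>c - t\<close>. Superlinear growth makes that slope as large as
  desired.\<close>

lemma tangent_at_top: "\<exists>R. \<forall>v\<ge>R. tangent f v t \<le> B"
proof -
  define c where "c = max t m + 1"
  \<comment> \<open>a slope of at least \<open>K\<close> makes the tangent drop by \<open>K\<close> or more between \<open>c\<close> and \<open>t\<close>\<close>
  define K where "K = \<bar>f c - B\<bar>"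
  obtain R where R: "\<And>x. R \<le> \<bar>x - m\<bar> \<Longrightarrow> K * \<bar>x - m\<bar> \<le> f x"
    using superlinear[of K] by blast
  have "tangent f v t \<le> B" if "max (m + R) (m + 1) \<le> v" for v
  proof -
    have v: "m < v" "R \<le> \<bar>v - m\<bar>" using that by auto
    have "K * (v - m) \<le> deriv f v * (v - m)"
      using R[OF v(2)] tangent_le[of v m] v(1) minimum
      by (simp add: tangent_def algebra_simps)
    then have K: "0 \<le> K" "K \<le> deriv f v"
      using v(1) by (auto simp: K_def)
    have "tangent f v t = tangent f v c - deriv f v * (c - t)"
      by (simp add: tangent_def algebra_simps)
    also have "\<dots> \<le> f c - K * 1"
      using tangent_le[of v c] v(1) K by (intro diff_mono mult_mono) (auto simp: c_def)
    also have "\<dots> \<le> B"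
      by (simp add: K_def)
    finally show ?thesis .
  qed
  then show ?thesis by blast
qed

text \<open>Slopes between the minimum and \<open>w\<close> lie between \<open>0\<close> and \<open>deriv f w\<close>; hence tangents there
  stay bounded below at \<open>t\<close> even if \<open>f\<close> has a kink at \<open>m\<close>.\<close>

lemma tangent_near_minimum: "\<exists>B. \<forall>v. m < v \<and> v \<le> w \<longrightarrow> B \<le> tangent f v t"
proof (intro exI allI impI)
  fix v assume v: "m < v \<and> v \<le> w"
  have "0 \<le> deriv f v * (v - m)"
    using tangent_le[of v m] minimum(1) minimum(2)[of v] v by (simp add: tangent_def algebra_simps)
  then have d: "0 \<le> deriv f v" "deriv f v \<le> deriv f w"
    using v deriv_less[of v w] by (cases "v = w"; auto simp: zero_le_mult_iff)+
  have "- (deriv f w * (\<bar>t - m\<bar> + (w - m))) \<le> - (deriv f v * \<bar>t - v\<bar>)"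
    using d v by (intro le_imp_neg_le mult_mono) auto
  also have "\<dots> \<le> deriv f v * (t - v)"
    using mult_left_mono[OF abs_ge_minus_self[of "t - v"] d(1)] by linarith
  also have "\<dots> \<le> tangent f v t"
    using minimum(2)[of v] by (simp add: tangent_def)
  finally show "- (deriv f w * (\<bar>t - m\<bar> + (w - m))) \<le> tangent f v t" .
qed

text \<open>The dual certificate. Dividing by \<open>deriv f v2 - deriv f v1\<close> normalizes the difference of the two
  tangents to \<open>x - t\<close>, so that \<open>F\<close> measures the gap to one tangent as seen from \<open>0\<close> and the gap to
  the other as seen from \<open>x - t\<close>.\<close>

lemma tangents_meet_majorant:
  assumes v: "v1 < m" "m < v2" and meet: "tangent f v1 t = tangent f v2 t"
  defines "F \<equiv> \<lambda>x. (f x - tangent f v1 x) / (deriv f v2 - deriv f v1)"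
  shows "max (x - t) 0 \<le> F x" and "F x = max (x - t) 0 \<longleftrightarrow> x = v1 \<or> x = v2"
proof -
  define d where "d = deriv f v2 - deriv f v1"
  have d: "0 < d" using deriv_less[of v1 v2] v by (simp add: d_def)
  have "tangent f v2 x - tangent f v1 x = d * (x - t)" for x
    using meet by (simp add: tangent_def d_def algebra_simps)
  then have F2: "F x = (x - t) + (f x - tangent f v2 x) / d" for x
    using d unfolding F_def d_def[symmetric] by (simp add: field_simps)
  have F1: "F x = (f x - tangent f v1 x) / d" for x
    by (simp add: F_def d_def)
  have pos1: "0 \<le> F x" "F x = 0 \<longleftrightarrow> x = v1" for x
    using tangent_less[of v1 x] v d by (cases "x = v1"; simp add: F1 tangent_def)+
  have pos2: "x - t \<le> F x" "F x = x - t \<longleftrightarrow> x = v2" for x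
    using tangent_less[of v2 x] v d by (cases "x = v2"; simp add: F2 tangent_def)+
  show "max (x - t) 0 \<le> F x"
    using pos1 pos2 by simp
  show "F x = max (x - t) 0 \<longleftrightarrow> x = v1 \<or> x = v2"
    using pos1[of x] pos2[of x] by (auto simp: max_def)
qed

section \<open>Lines through a point above the minimum\<close>

text \<open>At \<open>m\<close> the graph lies strictly below a line through \<open>(m, s)\<close>. By convexity it stays below up
  to the intersection point \<open>v\<close> and above from there on; comparing the graph with the line at \<open>y\<close>
  thus locates \<open>y\<close> relative to \<open>v\<close>.\<close>

lemma right_root_order:
  assumes "0 < s" "m < v" "f v = s + c * (v - m)" "m < y"
  shows "f y < s + c * (y - m) \<longleftrightarrow> y < v" and "s + c * (y - m) < f y \<longleftrightarrow> v < y"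
proof -
  have below: "f b < s + c * (b - m)" if "m < b" "b < e" "f e \<le> s + c * (e - m)" for b e
  proof -
    define u where "u = (b - m) / (e - m)"
    have u: "0 < u" "u < 1" "u * (e - m) = b - m"
      using that by (auto simp: u_def)
    have b: "(1 - u) * m + u * e = b"
      using u(3) by (simp add: algebra_simps)
    have "f ((1 - u) * m + u * e) < (1 - u) * f m + u * f e"
      using that u by (intro strict_chord) auto
    then have "f ((1 - u) * m + u * e) < u * f e"
      using minimum(1) by simp
    then have "f b < u * f e"
      by (simp only: b)
    also have "\<dots> \<le> u * (s + c * (e - m))"
      using that(3) u(1) by (intro mult_left_mono) auto
    also have "\<dots> = u * s + c * (b - m)"
      by (simp add: u(3)[symmetric] algebra_simps)
    also have "\<dots> \<le> s + c * (b - m)"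
      using mult_right_mono[of u 1 s] u assms(1) by simp
    finally show ?thesis .
  qed
  consider "y < v" | "y = v" | "v < y"
    by linarith
  then have "(f y < s + c * (y - m) \<longleftrightarrow> y < v) \<and> (s + c * (y - m) < f y \<longleftrightarrow> v < y)"
  proof cases
    case 1
    then show ?thesis using below[of y v] assms by auto
  next
    case 2
    then show ?thesis using assms by simp
  next
    case 3
    then have "\<not> f y \<le> s + c * (y - m)"
      using below[of v y] assms by auto
    with 3 show ?thesis by simp
  qed
  then show "f y < s + c * (y - m) \<longleftrightarrow> y < v" "s + c * (y - m) < f y \<longleftrightarrow> v < y"
    by auto
qed

lemma right_root_exists:
  assumes "0 < s"
  shows "\<exists>v>m. f v = s + c * (v - m)"
proof -
  obtain R where R: "\<And>x. R \<le> \<bar>x - m\<bar> \<Longrightarrow> (c + 1) * \<bar>x - m\<bar> \<le> f x"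
    using superlinear[of "c + 1"] by blast
  define b where "b = m + max R s"
  have "(c + 1) * (b - m) \<le> f b" "s \<le> b - m"
    using R[of b] assms by (auto simp: b_def)
  then have b: "0 \<le> f b - (s + c * (b - m))" "m \<le> b"
    using assms by (auto simp: algebra_simps)
  have "\<exists>v\<ge>m. v \<le> b \<and> f v - (s + c * (v - m)) = 0"
    using b minimum(1) assms by (intro IVT') (auto intro!: continuous_intros continuous)
  then show ?thesis
    using minimum(1) assms by (metis add.right_neutral diff_self eq_iff_diff_eq_0 less_le mult_zero_right)
qed

text \<open>The abscissa \<open>v c\<close> of the right intersection with the line of slope \<open>c\<close>. Monotonicity, continuity
  and divergence of \<open>v\<close> all follow from the fact that \<open>y < v c\<close> is a strict inequality between \<open>f y\<close>
  and an affine function of \<open>c\<close>.\<close>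

lemma right_branch:
  assumes "0 < s"
  obtains v where "\<And>c. m < v c" "\<And>c. f (v c) = s + c * (v c - m)"
    "continuous_on UNIV (\<lambda>c. tangent f (v c) t)"
    "\<And>B. \<exists>C. \<forall>c\<ge>C. tangent f (v c) t \<le> B"
    "\<exists>B. \<forall>c\<le>0. B \<le> tangent f (v c) t"
proof -
  obtain v where v: "\<And>c. m < v c" "\<And>c. f (v c) = s + c * (v c - m)"
    using right_root_exists[OF assms] by metis
  have less: "f y < s + c * (y - m) \<longleftrightarrow> y < v c" if "m < y" for c y
    using right_root_order(1)[OF assms v(1) v(2) that] .
  have greater: "s + c * (y - m) < f y \<longleftrightarrow> v c < y" if "m < y" for c y
    using right_root_order(2)[OF assms v(1) v(2) that] .
  have mono: "v a \<le> v b" if "a \<le> b" for a b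
  proof (rule ccontr)
    assume "\<not> v a \<le> v b"
    then have "f (v b) < s + a * (v b - m)"
      using less[OF v(1)] by auto
    moreover have "a * (v b - m) \<le> b * (v b - m)"
      using that v(1)[of b] by (intro mult_right_mono) auto
    ultimately show False
      using v(2)[of b] by simp
  qed
  have cont: "isCont v c" for c
    unfolding isCont_def
  proof (rule order_tendstoI)
    fix y assume y: "y < v c"
    have line: "((\<lambda>c. s + c * (y - m)) \<longlongrightarrow> s + c * (y - m)) (at c)"
      by (intro tendsto_intros)
    show "\<forall>\<^sub>F c in at c. y < v c"
    proof (cases "m < y")
      case True
      then show ?thesis
        using order_tendstoD(1)[OF line, of "f y"] y less by simp
    next
      case False
      then show ?thesis
        using v(1) by (intro always_eventually) (meson le_less_trans linorder_not_less)
    qed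
  next
    fix y assume y: "v c < y"
    then have "m < y"
      using v(1)[of c] by simp
    have line: "((\<lambda>c. s + c * (y - m)) \<longlongrightarrow> s + c * (y - m)) (at c)"
      by (intro tendsto_intros)
    show "\<forall>\<^sub>F c in at c. v c < y"
      using order_tendstoD(2)[OF line, of "f y"] y greater[OF \<open>m < y\<close>] by simp
  qed
  have "continuous_on UNIV (\<lambda>c. tangent f (v c) t)"
    unfolding continuous_on_eq_continuous_at[OF open_UNIV]
    by (intro ballI isCont_o2[OF cont] isCont_tangent) (use v(1) in \<open>auto simp: less_imp_neq[symmetric]\<close>)
  moreover have "\<exists>C. \<forall>c\<ge>C. tangent f (v c) t \<le> B" for B
  proof -
    obtain R where R: "\<And>w. R \<le> w \<Longrightarrow> tangent f w t \<le> B"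
      using tangent_at_top by blast
    define z where "z = max R (m + 1)"
    have z: "m < z" "R \<le> z" "0 < z - m" by (auto simp: z_def)
    \<comment> \<open>\<open>f z / (z - m)\<close> is the slope of the line from \<open>(m, 0)\<close> through the graph at \<open>z\<close>; since
      \<open>s > 0\<close>, lines through \<open>(m, s)\<close> of at least that slope pass above it\<close>
    have "f z < s + c * (z - m)" if "f z / (z - m) \<le> c" for c
      using that z(3) assms by (simp add: pos_divide_le_eq)
    then have "\<forall>c\<ge>f z / (z - m). tangent f (v c) t \<le> B"
      using less[OF z(1)] z R by (meson less_le order_trans)
    then show ?thesis by blast
  qed
  moreover have "\<exists>B. \<forall>c\<le>0. B \<le> tangent f (v c) t"
    using tangent_near_minimum[of "v 0" t] mono v(1) by meson
  ultimately show ?thesis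
    using that v by blast
qed

end

lemma has_real_derivative_reflect:
  fixes f :: "real \<Rightarrow> real"
  assumes "f differentiable (at (a - x))"
  shows "((\<lambda>x. f (a - x)) has_real_derivative - deriv f (a - x)) (at x)"
proof -
  have "(f has_real_derivative deriv f (a - x)) (at (a - x))"
    using assms by (simp add: DERIV_deriv_iff_real_differentiable)
  then have "((\<lambda>x. f (a - x)) has_real_derivative deriv f (a - x) * (- 1)) (at x)"
    by (rule DERIV_chain2) (auto intro!: derivative_eq_intros)
  then show ?thesis
    by simp
qed

context convex_well
begin

lemma reflect: "convex_well (\<lambda>x. f (2 * m - x)) m"
proof
  show "strictly_convex_on UNIV (\<lambda>x. f (2 * m - x))"
    unfolding strictly_convex_on_def
  proof (intro conjI ballI allI impI convex_UNIV)
    fix x y u :: real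
    assume "x \<noteq> y \<and> 0 < u \<and> u < 1"
    then show "f (2 * m - ((1 - u) * x + u * y)) < (1 - u) * f (2 * m - x) + u * f (2 * m - y)"
      using strict_chord[of "2 * m - x" "2 * m - y" u] by (simp add: algebra_simps)
  qed
  show "(\<lambda>x. f (2 * m - x)) differentiable (at x)" if "x \<noteq> m" for x
    using has_real_derivative_reflect[OF differentiable, of "2 * m" x] that
    by (auto simp: real_differentiable_def)
  show "\<exists>R. \<forall>x. R \<le> \<bar>x - m\<bar> \<longrightarrow> K * \<bar>x - m\<bar> \<le> f (2 * m - x)" for K
  proof -
    obtain R where R: "\<And>x. R \<le> \<bar>x - m\<bar> \<Longrightarrow> K * \<bar>x - m\<bar> \<le> f x"
      using superlinear[of K] by blast
    have "\<bar>2 * m - x - m\<bar> = \<bar>x - m\<bar>" for x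
      by linarith
    then show ?thesis
      using R by metis
  qed
qed (use minimum in auto)

lemma tangent_reflect:
  "v \<noteq> m \<Longrightarrow> tangent (\<lambda>x. f (2 * m - x)) v (2 * m - t) = tangent f (2 * m - v) t"
  using DERIV_imp_deriv[OF has_real_derivative_reflect[OF differentiable, of "2 * m" v]]
  by (auto simp: tangent_def right_diff_distrib)

text \<open>In the reflected function the line of slope \<open>c\<close> acquires slope \<open>-c\<close>, so the left intersection for
  slope \<open>c\<close> is \<open>2 * m - u (- c)\<close>, where \<open>u\<close> is the right branch of the reflected function. \<open>H\<close>
  compares the values at \<open>t\<close> of the two tangents; a zero of \<open>H\<close> is the chord wanted.\<close>

lemma common_tangent_supports_exist:
  assumes "0 < s"
  obtains v1 v2 where "v1 < m" "m < v2" "tangent f v1 t = tangent f v2 t"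
    "(v2 - m) / (v2 - v1) * f v1 + (m - v1) / (v2 - v1) * f v2 = s"
proof -
  obtain v where v: "\<And>c. m < v c" "\<And>c. f (v c) = s + c * (v c - m)"
    and cont: "continuous_on UNIV (\<lambda>c. tangent f (v c) t)"
    and down: "\<And>B. \<exists>C. \<forall>c\<ge>C. tangent f (v c) t \<le> B"
    and low: "\<exists>B. \<forall>c\<le>0. B \<le> tangent f (v c) t"
    by (rule right_branch[OF assms, of t]) blast
  interpret reflected: convex_well "\<lambda>x. f (2 * m - x)" m
    by (rule reflect)
  obtain u where u: "\<And>c. m < u c" "\<And>c. f (2 * m - u c) = s + c * (u c - m)"
    and cont': "continuous_on UNIV (\<lambda>c. tangent f (2 * m - u c) t)"
    and down': "\<And>B. \<exists>C. \<forall>c\<ge>C. tangent f (2 * m - u c) t \<le> B"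
    and low': "\<exists>B. \<forall>c\<le>0. B \<le> tangent f (2 * m - u c) t"
  proof (rule reflected.right_branch[OF assms, of "2 * m - t"], goal_cases)
    case (1 u)
    from 1(2) have "u c \<noteq> m" for c
      by (metis less_irrefl)
    then show ?case
      using 1(1)[of u] 1(2-6) by (simp add: tangent_reflect)
  qed
  define H where "H c = tangent f (v c) t - tangent f (2 * m - u (- c)) t" for c
  have "continuous_on UNIV (\<lambda>c. tangent f (2 * m - u (- c)) t)"
    by (rule continuous_on_compose2[OF cont']) (auto intro: continuous_intros)
  then have "continuous_on UNIV H"
    unfolding H_def by (intro continuous_on_diff cont)
  then have H: "continuous_on A H" for A
    by (rule continuous_on_subset) simp
  obtain B where B: "\<And>c. c \<le> 0 \<Longrightarrow> B \<le> tangent f (2 * m - u c) t"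
    using low' by blast
  obtain C where C: "\<And>c. C \<le> c \<Longrightarrow> tangent f (v c) t \<le> B"
    using down by blast
  obtain B' where B': "\<And>c. c \<le> 0 \<Longrightarrow> B' \<le> tangent f (v c) t"
    using low by blast
  obtain C' where C': "\<And>c. C' \<le> c \<Longrightarrow> tangent f (2 * m - u c) t \<le> B'"
    using down' by blast
  have "\<exists>c\<ge>- max C' 0. c \<le> max C 0 \<and> H c = 0"
  proof (rule IVT2')
    show "H (max C 0) \<le> 0"
      using B[of "- max C 0"] C[of "max C 0"] by (simp add: H_def)
    show "0 \<le> H (- max C' 0)"
      using B'[of "- max C' 0"] C'[of "max C' 0"] by (simp add: H_def)
  qed (auto intro: H)
  then obtain c where c: "H c = 0"
    by blast
  define v1 where "v1 = 2 * m - u (- c)"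
  have v1: "v1 < m" "f v1 = s + c * (v1 - m)"
    using u[of "- c"] by (auto simp: v1_def algebra_simps)
  have "(v c - m) * f v1 + (m - v1) * f (v c) = s * (v c - v1)"
    by (simp add: v(2)[of c] v1(2) algebra_simps)
  then have "(v c - m) / (v c - v1) * f v1 + (m - v1) / (v c - v1) * f (v c) = s"
    using v(1)[of c] v1(1) by (simp add: add_divide_distrib[symmetric] divide_eq_eq)
  then show ?thesis
    using that[of v1 "v c"] v1(1) v(1) c by (simp add: H_def v1_def)
qed

end

section \<open>Two-point distributions\<close>

text \<open>The masses of the two points determine the expectation of every indicator function.\<close>

lemma two_point_distribution_unique:
  assumes P: "two_point_distribution P v1 v2 w1 w2" and Q: "two_point_distribution Q v1 v2 w1 w2"
  shows "P = Q"
proof (rule measure_eqI)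
  interpret P: real_distribution P
    using P by (simp add: two_point_distribution_def)
  interpret Q: real_distribution Q
    using Q by (simp add: two_point_distribution_def)
  show "sets P = sets Q"
    by simp
  fix A assume "A \<in> sets P"
  then have A: "(indicator A :: real \<Rightarrow> real) \<in> borel_measurable borel"
    by simp
  have "P.prob A = Q.prob A"
    using two_point_distribution_integral[OF P A] two_point_distribution_integral[OF Q A]
    by (simp add: has_expectation_def)
  then show "emeasure P A = emeasure Q A"
    by (simp add: P.emeasure_eq_measure Q.emeasure_eq_measure)
qed

lemma two_point_distribution_exists:
  assumes "v1 < v2" "0 < w1" "0 < w2" "w1 + w2 = 1"
  shows "\<exists>P. two_point_distribution P v1 v2 w1 w2"
proof -
  let ?h = "\<lambda>b. if b then v2 else v1"
  let ?P = "distr (measure_pmf (bernoulli_pmf w2)) borel ?h"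
  have "real_distribution ?P"
    by (intro real_distribution.intro real_distribution_axioms.intro measure_pmf.prob_space_distr) auto
  moreover have "measure ?P {v1} = w1" "measure ?P {v2} = w2"
  proof -
    have "?h -` {v1} = {False}" "?h -` {v2} = {True}"
      using assms(1) by (auto split: if_splits)
    then show "measure ?P {v1} = w1" "measure ?P {v2} = w2"
      using assms by (auto simp: measure_distr measure_pmf_single)
  qed
  ultimately show ?thesis
    using assms unfolding two_point_distribution_def by blast
qed

text \<open>Total mass \<open>1\<close> and mean \<open>m\<close> are two linear equations for the masses of the two points.\<close>

lemma two_point_distributionI:
  assumes P: "real_distribution P" and mean: "has_expectation P (\<lambda>x. x) m"
    and supp: "AE x in P. x = v1 \<or> x = v2" and v: "v1 < m" "m < v2"
  shows "two_point_distribution P v1 v2 ((v2 - m) / (v2 - v1)) ((m - v1) / (v2 - v1))"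
proof -
  interpret real_distribution P by fact
  have "AE x in P. x \<in> {v1} \<union> {v2}"
    using supp by (rule eventually_mono) auto
  then have "prob ({v1} \<union> {v2}) = 1"
    by (subst prob_eq_1) auto
  then have one: "prob {v1} + prob {v2} = 1"
    using v by (subst (asm) finite_measure_Union) auto
  let ?g = "\<lambda>x. v1 * indicator {v1} x + v2 * indicator {v2} x :: real"
  have "m = (\<integral>x. x \<partial>P)"
    using mean by (simp add: has_expectation_def)
  also have "\<dots> = (\<integral>x. ?g x \<partial>P)"
    using supp v by (intro integral_cong_AE) (auto elim!: eventually_mono)
  also have "\<dots> = v1 * prob {v1} + v2 * prob {v2}"
    by (subst Bochner_Integration.integral_add) (auto simp: emeasure_eq_measure)
  finally have m: "m = v1 * prob {v1} + v2 * prob {v2}" .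
  have w1: "prob {v1} = 1 - prob {v2}"
    using one by simp
  have "prob {v1} * (v2 - v1) = v2 - m" "prob {v2} * (v2 - v1) = m - v1"
    unfolding m w1 by (simp_all add: algebra_simps)
  then show ?thesis
    using v P unfolding two_point_distribution_def
    by (auto simp: eq_divide_eq add_divide_distrib[symmetric])
qed

section \<open>Optimality by duality\<close>

context convex_well
begin

text \<open>\<open>M\<close> is the expectation of the majorant \<open>F\<close>, common to the whole ambiguity set. The gap between
  \<open>F\<close> and the excess is nonnegative, and it has expectation zero only if it vanishes almost surely,
  that is, if almost all mass sits on the contact points.\<close>

lemma expected_excess_le:
  assumes v: "v1 < m" "m < v2" and meet: "tangent f v1 t = tangent f v2 t"
    and R: "R \<in> ambiguity_set m s f"
  defines "M \<equiv> (s - tangent f v1 m) / (deriv f v2 - deriv f v1)"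
  shows "(\<integral>x. max (x - t) 0 \<partial>R) \<le> M"
    and "(\<integral>x. max (x - t) 0 \<partial>R) = M \<longleftrightarrow>
      two_point_distribution R v1 v2 ((v2 - m) / (v2 - v1)) ((m - v1) / (v2 - v1))"
proof -
  interpret real_distribution R
    using R by (simp add: ambiguity_set_def)
  have mean: "has_expectation R (\<lambda>x. x) m" and I: "integrable R (\<lambda>x. x)" "integrable R f"
    "(\<integral>x. x \<partial>R) = m" "(\<integral>x. f x \<partial>R) = s"
    using R by (auto simp: ambiguity_set_def has_expectation_def)
  define F where "F x = (f x - tangent f v1 x) / (deriv f v2 - deriv f v1)" for x
  have F: "max (x - t) 0 \<le> F x" "F x = max (x - t) 0 \<longleftrightarrow> x = v1 \<or> x = v2" for x
    unfolding F_def by (rule tangents_meet_majorant[OF v meet])+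
  have T: "integrable R (tangent f v1)" "(\<integral>x. tangent f v1 x \<partial>R) = tangent f v1 m"
    unfolding tangent_def using I prob_space by simp_all
  have IF: "integrable R F" "(\<integral>x. F x \<partial>R) = M"
    using I T by (auto simp: F_def[abs_def] M_def)
  have IE: "integrable R (\<lambda>x. max (x - t) 0)"
    using I by (intro integrable_max) auto
  have gap: "M - (\<integral>x. max (x - t) 0 \<partial>R) = (\<integral>x. F x - max (x - t) 0 \<partial>R)"
    using IF IE by simp
  have nonneg: "0 \<le> F x - max (x - t) 0" for x
    using F(1) by simp
  have "0 \<le> M - (\<integral>x. max (x - t) 0 \<partial>R)"
    unfolding gap by (rule Bochner_Integration.integral_nonneg) (rule nonneg)
  then show "(\<integral>x. max (x - t) 0 \<partial>R) \<le> M"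
    by simp
  have "(\<integral>x. max (x - t) 0 \<partial>R) = M \<longleftrightarrow> (\<integral>x. F x - max (x - t) 0 \<partial>R) = 0"
    using gap by auto
  also have "\<dots> \<longleftrightarrow> (AE x in R. x = v1 \<or> x = v2)"
    using IF IE nonneg F(2) by (subst integral_nonneg_eq_0_iff_AE) auto
  also have "\<dots> \<longleftrightarrow> two_point_distribution R v1 v2 ((v2 - m) / (v2 - v1)) ((m - v1) / (v2 - v1))"
    (is "?L \<longleftrightarrow> ?R")
  proof
    assume ?L
    then show ?R
      using two_point_distributionI[OF _ mean _ v] real_distribution_axioms by blast
  next
    assume tp: ?R
    then have "prob {v1} + prob {v2} = 1"
      by (simp add: two_point_distribution_def)
    then have "prob ({v1} \<union> {v2}) = 1"
      using v by (subst finite_measure_Union) auto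
    then have "AE x in R. x \<in> {v1} \<union> {v2}"
      by (subst (asm) prob_eq_1) auto
    then show ?L by (rule eventually_mono) auto
  qed
  finally show "(\<integral>x. max (x - t) 0 \<partial>R) = M \<longleftrightarrow>
      two_point_distribution R v1 v2 ((v2 - m) / (v2 - v1)) ((m - v1) / (v2 - v1))" .
qed

text \<open>The two-point distribution is itself feasible, by the second equation of the system, so that the
  dual bound is attained and maximizing means attaining it.\<close>

lemma is_arg_max_iff_two_point:
  assumes v: "v1 < m" "m < v2" and meet: "tangent f v1 t = tangent f v2 t"
    and level: "(v2 - m) / (v2 - v1) * f v1 + (m - v1) / (v2 - v1) * f v2 = s"
  shows "is_arg_max (\<lambda>R. \<integral>x. max (x - t) 0 \<partial>R) (\<lambda>R. R \<in> ambiguity_set m s f) Q \<longleftrightarrow>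
    two_point_distribution Q v1 v2 ((v2 - m) / (v2 - v1)) ((m - v1) / (v2 - v1))"
    (is "?max Q \<longleftrightarrow> ?tp Q")
proof -
  let ?w1 = "(v2 - m) / (v2 - v1)" and ?w2 = "(m - v1) / (v2 - v1)"
  have w: "0 < ?w1" "0 < ?w2" "?w1 + ?w2 = 1"
    using v by (auto simp: add_divide_distrib[symmetric])
  have "(v2 - m) * v1 + (m - v1) * v2 = m * (v2 - v1)"
    by (simp add: algebra_simps)
  then have mean: "?w1 * v1 + ?w2 * v2 = m"
    using v by (simp add: add_divide_distrib[symmetric] divide_eq_eq)
  have feasible: "R \<in> ambiguity_set m s f" if "?tp R" for R
    using two_point_distribution_integral[OF that, of "\<lambda>x. x"]
      two_point_distribution_integral[OF that borel_measurable] that level mean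
    by (simp add: ambiguity_set_def two_point_distribution_def)
  obtain P where P: "?tp P"
    using two_point_distribution_exists[of v1 v2 ?w1 ?w2] v w by auto
  note bound = expected_excess_le[OF v meet]
  show ?thesis
  proof
    assume Q: "?max Q"
    then have "\<not> (\<integral>x. max (x - t) 0 \<partial>Q) < (\<integral>x. max (x - t) 0 \<partial>P)" "Q \<in> ambiguity_set m s f"
      using feasible[OF P] by (auto simp: is_arg_max_def)
    then show "?tp Q"
      using bound[of Q s] bound(2)[of P s] P feasible[OF P] by force
  next
    assume Q: "?tp Q"
    then have "(\<integral>x. max (x - t) 0 \<partial>R) \<le> (\<integral>x. max (x - t) 0 \<partial>Q)" if "R \<in> ambiguity_set m s f" for R
      using bound(1)[OF that] bound(2)[OF feasible[OF Q]] by simp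
    then show "?max Q"
      using feasible[OF Q] by (auto simp: is_arg_max_def not_less)
  qed
qed

end

text \<open>Passing from \<open>\<bar>x\<bar>\<close> to \<open>\<bar>x - m\<bar>\<close> in the growth condition costs a factor \<open>2\<close> far away from the origin,
  where \<open>\<bar>x - m\<bar> \<le> 2 * \<bar>x\<bar>\<close>.\<close>

lemma convex_wellI:
  fixes f :: "real \<Rightarrow> real"
  assumes "strictly_convex_on UNIV f" and "f differentiable_on (UNIV - {m})"
    and lim: "filterlim (\<lambda>x. \<bar>f x / x\<bar>) at_top at_infinity"
    and "f m = 0" and min: "\<forall>x. f m \<le> f x"
  shows "convex_well f m"
proof
  show "f differentiable (at x)" if "x \<noteq> m" for x
    using assms(2) that by (simp add: differentiable_on_eq_differentiable_at open_delete)
  show nonneg: "0 \<le> f x" for x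
    using min assms(4) by metis
  show "\<exists>R. \<forall>x. R \<le> \<bar>x - m\<bar> \<longrightarrow> K * \<bar>x - m\<bar> \<le> f x" for K
  proof -
    have "\<forall>\<^sub>F x in at_infinity. 2 * \<bar>K\<bar> \<le> \<bar>f x / x\<bar>"
      using lim by (simp add: filterlim_at_top)
    then obtain b where b: "\<And>x. b \<le> \<bar>x\<bar> \<Longrightarrow> 2 * \<bar>K\<bar> \<le> \<bar>f x / x\<bar>"
      by (auto simp: eventually_at_infinity)
    have "K * \<bar>x - m\<bar> \<le> f x" if "\<bar>b\<bar> + 2 * \<bar>m\<bar> + 1 \<le> \<bar>x - m\<bar>" for x
    proof -
      have x: "b \<le> \<bar>x\<bar>" "x \<noteq> 0" "\<bar>x - m\<bar> \<le> 2 * \<bar>x\<bar>"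
        using that by auto
      have "K * \<bar>x - m\<bar> \<le> \<bar>K\<bar> * (2 * \<bar>x\<bar>)"
        using x(3) by (intro mult_mono) auto
      also have "\<dots> \<le> \<bar>f x\<bar>"
        using b[OF x(1)] x(2) by (simp add: pos_le_divide_eq algebra_simps)
      finally show ?thesis
        using nonneg[of x] by simp
    qed
    then show ?thesis by blast
  qed
qed (use assms in auto)

theorem theorem3p4:
  fixes \<mu> s t :: real and \<phi> :: "real \<Rightarrow> real"
  assumes "\<mu> > 0" and "s > 0"
    and "strictly_convex_on UNIV \<phi>"
    and "\<phi> differentiable_on (UNIV - {\<mu>})"
    and "filterlim (\<lambda>x. \<bar>\<phi> x / x\<bar>) at_top at_infinity"
    and "\<phi> \<mu> = 0"
    and "\<forall>x. \<phi> \<mu> \<le> \<phi> x"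
  shows "\<exists>P.
    (\<forall>Q. is_arg_max (\<lambda>R. \<integral>x. max (x - t) 0 \<partial>R) (\<lambda>R. R \<in> ambiguity_set \<mu> s \<phi>) Q
          \<longleftrightarrow> Q = P) \<and>
    (\<forall>Q. (\<exists>v1 v2 w1 w2.
            two_point_distribution Q v1 v2 w1 w2 \<and> has_expectation Q (\<lambda>x. x) \<mu> \<and>
            v1 < \<mu> \<and> \<mu> < v2 \<and>
            (v1 - t) * deriv \<phi> v1 - \<phi> v1 = (v2 - t) * deriv \<phi> v2 - \<phi> v2 \<and>
            (v2 - \<mu>) / (v2 - v1) * \<phi> v1 + (\<mu> - v1) / (v2 - v1) * \<phi> v2 = s)
          \<longleftrightarrow> Q = P)"
proof -
  interpret convex_well \<phi> \<mu>
    using assms(3-7) by (rule convex_wellI)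
  let ?max = "is_arg_max (\<lambda>R. \<integral>x. max (x - t) 0 \<partial>R) (\<lambda>R. R \<in> ambiguity_set \<mu> s \<phi>)"
  let ?tp = "\<lambda>v1 v2 Q. two_point_distribution Q v1 v2 ((v2 - \<mu>) / (v2 - v1)) ((\<mu> - v1) / (v2 - v1))"
  have meet_iff: "(v1 - t) * deriv \<phi> v1 - \<phi> v1 = (v2 - t) * deriv \<phi> v2 - \<phi> v2 \<longleftrightarrow>
      tangent \<phi> v1 t = tangent \<phi> v2 t" for v1 v2
    by (auto simp: tangent_def algebra_simps)
  obtain a b where ab: "a < \<mu>" "\<mu> < b" "tangent \<phi> a t = tangent \<phi> b t"
    "(b - \<mu>) / (b - a) * \<phi> a + (\<mu> - a) / (b - a) * \<phi> b = s"
    using common_tangent_supports_exist[OF \<open>s > 0\<close>] by blast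
  have "0 < (b - \<mu>) / (b - a)" "0 < (\<mu> - a) / (b - a)" "(b - \<mu>) / (b - a) + (\<mu> - a) / (b - a) = 1"
    using ab(1,2) by (auto simp: add_divide_distrib[symmetric])
  then obtain P where P: "?tp a b P"
    using two_point_distribution_exists[of a b] ab(1,2) by fastforce
  have max_iff: "?max Q \<longleftrightarrow> Q = P" for Q
    unfolding is_arg_max_iff_two_point[OF ab] using P two_point_distribution_unique by blast
  have "has_expectation P (\<lambda>x. x) \<mu>"
    using max_iff[of P] by (simp add: is_arg_max_def ambiguity_set_def)
  then have "\<exists>v1 v2 w1 w2. two_point_distribution P v1 v2 w1 w2 \<and> has_expectation P (\<lambda>x. x) \<mu> \<and>
      v1 < \<mu> \<and> \<mu> < v2 \<and>
      (v1 - t) * deriv \<phi> v1 - \<phi> v1 = (v2 - t) * deriv \<phi> v2 - \<phi> v2 \<and>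
      (v2 - \<mu>) / (v2 - v1) * \<phi> v1 + (\<mu> - v1) / (v2 - v1) * \<phi> v2 = s"
    using P ab unfolding meet_iff by blast
  moreover have "Q = P"
    if "two_point_distribution Q v1 v2 w1 w2" "has_expectation Q (\<lambda>x. x) \<mu>" "v1 < \<mu>" "\<mu> < v2"
      "(v1 - t) * deriv \<phi> v1 - \<phi> v1 = (v2 - t) * deriv \<phi> v2 - \<phi> v2"
      "(v2 - \<mu>) / (v2 - v1) * \<phi> v1 + (\<mu> - v1) / (v2 - v1) * \<phi> v2 = s" for Q v1 v2 w1 w2
  proof -
    have "?tp v1 v2 Q"
      using that(1) two_point_distribution_masses[OF that(1,2)] by simp
    then have "?max Q"
      using is_arg_max_iff_two_point[OF that(3,4) _ that(6)] that(5) unfolding meet_iff by blast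
    then show ?thesis
      using max_iff by simp
  qed
  ultimately show ?thesis
    using max_iff by (intro exI[of _ P]) blast
qed

end
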